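(* If $G$ is a connected $n$-vertex graph that is not a triangle (i.e. $G$ is not isomorphic to $K_3$), then $$\iota_{\rm c}(G) \leq \frac{n}{4}.$$ Consequently, for any integer $n \geq 1$, $$\iota_{\rm c}(n) = \iota_{\rm c}(B_{n,K_3}) = \left\lfloor \frac{n}{4} \right\rfloor.$$
   Context: All graphs are finite and simple. An $n$-vertex graph is a graph with exactly $n$ vertices. For a graph $G$ and $v \in V(G)$, $N[v]$ is the set consisting of $v$ and its neighbours; for $D \subseteq V(G)$, $N[D] = \bigcup_{v \in D} N[v]$, and $G - N[D]$ is the subgraph of $G$ induced by $V(G) \setminus N[D]$. A set $D \subseteq V(G)$ is a cycle isolating set of $G$ if $G - N[D]$ contains no cycle (of any length $\geq 3$), i.e. is a forest (the graph with no vertices counts as a forest). $\iota_{\rm c}(G)$ denotes the size of a smallest cycle isolating set of $G$. For an integer $n \geq 1$, $[n] = \{1,\dots,n\}$, and $\iota_{\rm c}(n)$ denotes the maximum of $\iota_{\rm c}(G)$ over all connected graphs $G$ with $V(G) = [n]$ and $G \not\simeq K_3$. $P_m$ denotes the path with vertex set $[m]$ and edges $\{i,i+1\}$, $1 \le i \le m-1$. The graph $B_{n,K_3}$ is defined as follows. If $n \leq 3$, then $B_{n,K_3} = P_n$. If $n \geq 4$, let $a = \lfloor n/4 \rfloor$ and $b = n - 3a$ (so $a \le b \le a+3$). Let $P^*$ be the graph with vertex set $[b]$ and edge set $E(P_a) \cup \{\{a,i\} \colon i \in [b] \setminus [a]\}$. Take copies $F_1, \dots, F_a$ of $K_3$ that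 are vertex-disjoint from each other and from $P^*$. Then $B_{n,K_3}$ is the connected $n$-vertex graph obtained from the union of $P^*, F_1, \dots, F_a$ by joining, for each $i \in [a]$, the vertex $i$ of $P^*$ to every vertex of $F_i$. *)

theory Defs
  imports Complex_Main
begin

record 'a sgraph =
  verts :: "'a set"
  edges :: "'a set set"

definition simple_graph :: "'a sgraph \<Rightarrow> bool" where
  "simple_graph G \<longleftrightarrow>
     finite (verts G) \<and> edges G \<subseteq> {{u, v} |u v. u \<in> verts G \<and> v \<in> verts G \<and> u \<noteq> v}"

(* The graph without vertices is connected under this definition, so statements
   about connected graphs cover it as well. *)
definition connected_graph :: "'a sgraph \<Rightarrow> bool" where
  "connected_graph G \<longleftrightarrow>
     (\<forall>u \<in> verts G. \<forall>v \<in> verts G. (\<lambda>x y. {x, y} \<in> edges G)\<^sup>*\<^sup>* u v)"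

definition graph_iso :: "'a sgraph \<Rightarrow> 'b sgraph \<Rightarrow> bool" where
  "graph_iso G H \<longleftrightarrow>
     (\<exists>f. bij_betw f (verts G) (verts H) \<and>
          (\<forall>u \<in> verts G. \<forall>v \<in> verts G. {u, v} \<in> edges G \<longleftrightarrow> {f u, f v} \<in> edges H))"

definition induced_subgraph :: "'a sgraph \<Rightarrow> 'a set \<Rightarrow> 'a sgraph" where
  "induced_subgraph G S = \<lparr>verts = verts G \<inter> S, edges = {e \<in> edges G. e \<subseteq> S}\<rparr>"

(* A cycle is given by the list of its vertices in cyclic order. *)
definition is_cycle :: "'a sgraph \<Rightarrow> 'a list \<Rightarrow> bool" where
  "is_cycle G c \<longleftrightarrow>
     3 \<le> length c \<and> distinct c \<and> set c \<subseteq> verts G \<and>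
     (\<forall>i < length c. {c ! i, c ! (Suc i mod length c)} \<in> edges G)"

definition closed_nbhd :: "'a sgraph \<Rightarrow> 'a \<Rightarrow> 'a set" where
  "closed_nbhd G v = insert v {u \<in> verts G. {u, v} \<in> edges G}"

definition closed_nbhd_set :: "'a sgraph \<Rightarrow> 'a set \<Rightarrow> 'a set" where
  "closed_nbhd_set G D = (\<Union>v \<in> D. closed_nbhd G v)"

definition cycle_isolating :: "'a sgraph \<Rightarrow> 'a set \<Rightarrow> bool" where
  "cycle_isolating G D \<longleftrightarrow>
     D \<subseteq> verts G \<and>
     (\<nexists>c. is_cycle (induced_subgraph G (verts G - closed_nbhd_set G D)) c)"

definition iota_c :: "'a sgraph \<Rightarrow> nat" where
  "iota_c G = (LEAST k. \<exists>D. cycle_isolating G D \<and> card D = k)"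

definition complete_graph_on :: "'a set \<Rightarrow> 'a sgraph" where
  "complete_graph_on S = \<lparr>verts = S, edges = {{u, v} |u v. u \<in> S \<and> v \<in> S \<and> u \<noteq> v}\<rparr>"

definition K3 :: "nat sgraph" where
  "K3 = complete_graph_on {1..3}"

definition path_graph :: "nat \<Rightarrow> nat sgraph" where
  "path_graph m = \<lparr>verts = {1..m}, edges = {{i, i + 1} |i. 1 \<le> i \<and> i < m}\<rparr>"

(* The maximum is over a finite set (there are finitely many graphs on {1..n}),
   which is nonempty for n \<ge> 1 because it contains the value at path_graph n. *)
definition iota_c_max :: "nat \<Rightarrow> nat" where
  "iota_c_max n =
     Max {iota_c G |G :: nat sgraph.
            simple_graph G \<and> connected_graph G \<and> verts G = {1..n} \<and> \<not> graph_iso G K3}"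

(* The i-th triangle is placed on {b + 3i - 2, b + 3i - 1, b + 3i}, so that the
   triangles occupy {b + 1..n} and the vertex set of the graph is {1..n}. *)
definition B_K3 :: "nat \<Rightarrow> nat sgraph" where
  "B_K3 n =
     (if n \<le> 3 then path_graph n
      else
        let a = n div 4;
            b = n - 3 * a;
            F = (\<lambda>i. complete_graph_on {b + 3 * i - 2..b + 3 * i})
        in \<lparr>verts = {1..b} \<union> (\<Union>i \<in> {1..a}. verts (F i)),
            edges = edges (path_graph a) \<union> {{a, i} |i. i \<in> {1..b} - {1..a}}
                    \<union> (\<Union>i \<in> {1..a}. edges (F i))
                    \<union> {{i, x} |i x. i \<in> {1..a} \<and> x \<in> verts (F i)}\<rparr>)"

end

theory Submission
  imports Defs
begin

text \<open>Upper bound, by induction on the number of vertices: if at least four vertices can be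
  discarded at the price of a single vertex \<open>w\<close>, so that no cycle of \<open>G - N[w]\<close> meets them, then
  the bound follows from the components of the rest, unless one of these is a triangle.
  If some \<open>G - x\<close> has a triangle component, discard \<open>x\<close> and all such triangles, with \<open>w = x\<close>.
  Otherwise take \<open>v\<close> of maximum degree (degree at most two is easy) and discard \<open>N[v]\<close>. If a
  triangle component \<open>H\<close> arises, discard \<open>H\<close> and a neighbour \<open>x\<close> of \<open>v\<close> attached to it, with \<open>w\<close>
  in \<open>H\<close>. The only triangle component that can then arise is the one containing \<open>v\<close>; this
  forces maximum degree three, and a short case distinction settles the remaining graphs.
  The lower bound holds because an isolating set of \<open>B\<close> must meet each of the disjoint sets
  \<open>{i} \<union> V(F\<^sub>i)\<close>.\<close>

section \<open>Components, cores and good vertex sets\<close>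

text \<open>One relation is fixed and induced subgraphs are represented by their vertex sets, so
  that the induction runs over sets \<open>S\<close>.\<close>

locale adjacency =
  fixes adj :: "'a \<Rightarrow> 'a \<Rightarrow> bool"
  assumes adj_sym: "adj u v \<Longrightarrow> adj v u"
    and adj_irrefl: "\<not> adj u u"
begin

text \<open>These are the unions of components of the graph induced on \<open>S\<close>.\<close>

definition closed_in :: "'a set \<Rightarrow> 'a set \<Rightarrow> bool" where
  "closed_in S A \<longleftrightarrow> A \<subseteq> S \<and> (\<forall>a\<in>A. \<forall>b\<in>S. adj a b \<longrightarrow> b \<in> A)"

definition conn :: "'a set \<Rightarrow> bool" where
  "conn S \<longleftrightarrow> (\<forall>A. closed_in S A \<and> A \<noteq> {} \<longrightarrow> A = S)"

definition component :: "'a set \<Rightarrow> 'a set \<Rightarrow> bool" where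
  "component S C \<longleftrightarrow> C \<noteq> {} \<and> closed_in S C \<and> conn C"

definition triangle :: "'a set \<Rightarrow> bool" where
  "triangle C \<longleftrightarrow> card C = 3 \<and> (\<forall>a\<in>C. \<forall>b\<in>C. a \<noteq> b \<longrightarrow> adj a b)"

text \<open>A finite graph contains a cycle iff some nonempty vertex set induces minimum degree at
  least two; such sets restrict to components and are easier to handle than cycles.\<close>

definition core :: "'a set \<Rightarrow> bool" where
  "core T \<longleftrightarrow> T \<noteq> {} \<and> (\<forall>t\<in>T. \<exists>a\<in>T. \<exists>b\<in>T. a \<noteq> b \<and> adj t a \<and> adj t b)"

definition nbhd :: "'a set \<Rightarrow> 'a set" where
  "nbhd D = {u. \<exists>d\<in>D. u = d \<or> adj d u}"

text \<open>A core in \<open>S\<close> that misses \<open>nbhd D\<close> is one that survives the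
  removal of N[D]; forbidding it says that \<open>D\<close> isolates all cycles within
  \<open>S\<close>.\<close>

definition good :: "'a set \<Rightarrow> bool" where
  "good S \<longleftrightarrow> (\<exists>D\<subseteq>S. 4 * card D \<le> card S \<and> (\<forall>T\<subseteq>S. core T \<longrightarrow> T \<inter> nbhd D \<noteq> {}))"

lemma coreE:
  assumes "core T" "t \<in> T"
  obtains a b where "a \<in> T" "b \<in> T" "a \<noteq> b" "adj t a" "adj t b"
  using assms unfolding core_def by blast

lemma core_restrict:
  assumes "core T" "T \<subseteq> S" "closed_in S C" "T \<inter> C \<noteq> {}"
  shows "core (T \<inter> C)"
  unfolding core_def
proof (intro conjI ballI)
  show "T \<inter> C \<noteq> {}" by fact
next
  fix t assume t: "t \<in> T \<inter> C"
  then obtain a b where "a \<in> T" "b \<in> T" "a \<noteq> b" "adj t a" "adj t b"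
    using assms(1) unfolding core_def by blast
  then show "\<exists>a\<in>T \<inter> C. \<exists>b\<in>T \<inter> C. a \<noteq> b \<and> adj t a \<and> adj t b"
    using t assms(2,3) unfolding closed_in_def by blast
qed

text \<open>A vertex with at most one neighbour left in \<open>T\<close> violates minimum degree
  two. Repeated use strips vertices from a possible core one by one.\<close>

lemma core_peel:
  assumes "core T" "\<And>b. b \<in> T \<Longrightarrow> adj t b \<Longrightarrow> b = a"
  shows "t \<notin> T"
  using assms unfolding core_def by metis

lemma closed_in_trans:
  assumes "closed_in S A" "closed_in A B"
  shows "closed_in S B"
  using assms unfolding closed_in_def by blast

lemma component_exists:
  assumes "finite S" "S \<noteq> {}"
  shows "\<exists>C. component S C"
proof -
  define P where "P A \<longleftrightarrow> closed_in S A \<and> A \<noteq> {}" for A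
  have "P S" using assms by (auto simp: P_def closed_in_def)
  then obtain C where C: "P C" "\<And>A. P A \<Longrightarrow> card C \<le> card A"
    using ex_has_least_nat[of P S card] by blast
  have "conn C" unfolding conn_def
  proof (intro allI impI)
    fix A assume A: "closed_in C A \<and> A \<noteq> {}"
    then have "closed_in S A" using closed_in_trans C(1) unfolding P_def by blast
    then have "card C \<le> card A" using A C(2) unfolding P_def by blast
    moreover have "A \<subseteq> C" using A unfolding closed_in_def by blast
    moreover have "finite C" using C(1) assms(1) finite_subset unfolding P_def closed_in_def by blast
    ultimately show "A = C" by (meson card_seteq)
  qed
  then show ?thesis using C(1) unfolding P_def component_def by blast
qed

text \<open>One component is split off. Components of the remainder are components of
  \<open>S\<close>, the two isolating sets are united, and a core that meets the split-off component
  restricts to a core inside it.\<close>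

lemma good_of_components:
  assumes "finite S" "\<And>C. component S C \<Longrightarrow> good C"
  shows "good S"
  using assms
proof (induction "card S" arbitrary: S rule: less_induct)
  case less
  show ?case
  proof (cases "S = {}")
    case True
    then show ?thesis unfolding good_def by (intro exI[of _ "{}"]) (simp add: core_def)
  next
    case False
    then obtain C where C: "component S C" using component_exists less.prems by blast
    have CS: "C \<subseteq> S" "C \<noteq> {}" "closed_in S C"
      using C unfolding component_def closed_in_def by auto
    have cl: "closed_in S (S - C)"
      using CS(3) adj_sym unfolding closed_in_def by blast
    have "good (S - C)"
    proof (rule less.hyps)
      show "card (S - C) < card S"
        using CS less.prems(1) by (intro psubset_card_mono) auto
      show "finite (S - C)" using less.prems(1) by simp
      fix C' assume "component (S - C) C'"
      then have "component S C'"
        using closed_in_trans[OF cl] unfolding component_def by simp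
      then show "good C'" using less.prems(2) by blast
    qed
    then obtain D1 where D1: "D1 \<subseteq> S - C" "4 * card D1 \<le> card (S - C)"
      "\<forall>T\<subseteq>S - C. core T \<longrightarrow> T \<inter> nbhd D1 \<noteq> {}" unfolding good_def by blast
    obtain D2 where D2: "D2 \<subseteq> C" "4 * card D2 \<le> card C"
      "\<forall>T\<subseteq>C. core T \<longrightarrow> T \<inter> nbhd D2 \<noteq> {}"
      using less.prems(2)[OF C] unfolding good_def by blast
    have fin: "finite C" using CS(1) less.prems(1) finite_subset by blast
    have "card (D1 \<union> D2) \<le> card D1 + card D2" by (rule card_Un_le)
    moreover have "card S = card (S - C) + card C"
      using fin CS(1) less.prems(1) by (simp add: card_Diff_subset card_mono)
    ultimately have "4 * card (D1 \<union> D2) \<le> card S" using D1(2) D2(2) by linarith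
    moreover have "T \<inter> nbhd (D1 \<union> D2) \<noteq> {}" if "T \<subseteq> S" "core T" for T
    proof (cases "T \<inter> C = {}")
      case True
      then have "T \<subseteq> S - C" using that(1) by blast
      then have "T \<inter> nbhd D1 \<noteq> {}" using D1(3) that(2) by simp
      then show ?thesis unfolding nbhd_def by blast
    next
      case False
      then have "core (T \<inter> C)" using core_restrict[OF that(2,1) CS(3)] by simp
      then have "(T \<inter> C) \<inter> nbhd D2 \<noteq> {}" using D2(3) by simp
      then show ?thesis unfolding nbhd_def by blast
    qed
    moreover have "D1 \<union> D2 \<subseteq> S" using D1(1) D2(1) CS(1) by blast
    ultimately show ?thesis unfolding good_def by (intro exI[of _ "D1 \<union> D2"]) simp
  qed
qed

section \<open>Discarding vertices at the price of one\<close>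

text \<open>The premises of \<open>avoid\<close> describe a core outside N[w]. Such a core lies in
  \<open>S - X\<close>, where the set obtained from the components catches it; the four vertices of
  \<open>X\<close> pay for \<open>w\<close>. \<open>X\<close> may extend beyond N[w], as long as no
  surviving core meets it.\<close>

lemma good_step:
  assumes "finite S" "X \<subseteq> S" "4 \<le> card X" "w \<in> S"
    and avoid: "\<And>T. core T \<Longrightarrow> T \<subseteq> S \<Longrightarrow> w \<notin> T \<Longrightarrow> (\<And>t. t \<in> T \<Longrightarrow> \<not> adj w t) \<Longrightarrow> T \<inter> X = {}"
    and comp: "\<And>C. component (S - X) C \<Longrightarrow> good C"
  shows "good S"
proof -
  have "good (S - X)" using good_of_components assms(1) comp by blast
  then obtain D where D: "D \<subseteq> S - X" "4 * card D \<le> card (S - X)"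
      "\<forall>T\<subseteq>S - X. core T \<longrightarrow> T \<inter> nbhd D \<noteq> {}" unfolding good_def by blast
  have "card (insert w D) \<le> Suc (card D)" by (rule card_insert_le_m1) auto
  moreover have "card S = card (S - X) + card X"
    using assms(1,2) by (simp add: card_Diff_subset card_mono finite_subset)
  ultimately have "4 * card (insert w D) \<le> card S" using D(2) assms(3) by linarith
  moreover have "T \<inter> nbhd (insert w D) \<noteq> {}" if T: "T \<subseteq> S" "core T" for T
  proof
    assume e: "T \<inter> nbhd (insert w D) = {}"
    then have "w \<notin> T" "\<And>t. t \<in> T \<Longrightarrow> \<not> adj w t" "T \<inter> nbhd D = {}"
      unfolding nbhd_def by blast+
    moreover from this have "T \<inter> X = {}" using avoid[OF T(2,1)] by simp
    then have "T \<subseteq> S - X" using T(1) by blast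
    ultimately show False using D(3) T(2) by simp
  qed
  moreover have "insert w D \<subseteq> S" using D(1) assms(4) by blast
  ultimately show ?thesis unfolding good_def by (intro exI[of _ "insert w D"]) simp
qed

section \<open>Triangles as components\<close>

lemma triangle_third:
  assumes "triangle C" "a \<in> C" "b \<in> C" "a \<noteq> b"
  obtains c where "C = {a, b, c}" "c \<noteq> a" "c \<noteq> b" "adj a b" "adj a c" "adj b c"
proof -
  have "card (C - {a, b}) = 1" using assms unfolding triangle_def by (simp add: card_Diff_subset)
  then obtain c where "C - {a, b} = {c}" using card_1_singletonE by blast
  then have "C = {a, b, c}" "c \<noteq> a" "c \<noteq> b" using assms by blast+
  moreover from this have "adj a b" "adj a c" "adj b c" using assms unfolding triangle_def by auto
  ultimately show ?thesis using that by blast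
qed

lemma triangle_other:
  assumes "triangle C" "a \<in> C"
  obtains b c where "C = {a, b, c}" "b \<noteq> a" "c \<noteq> a" "c \<noteq> b" "adj a b" "adj a c" "adj b c"
proof -
  have "C \<noteq> {a}" using assms unfolding triangle_def by auto
  then obtain b where b: "b \<in> C" "b \<noteq> a" using assms(2) by blast
  obtain c where "C = {a, b, c}" "c \<noteq> a" "c \<noteq> b" "adj a b" "adj a c" "adj b c"
    using triangle_third[OF assms b(1)] b(2) by metis
  then show ?thesis using that b by blast
qed

lemma exit_edge:
  assumes "conn S" "H \<subset> S" "H \<noteq> {}"
  obtains y x where "y \<in> H" "x \<in> S" "x \<notin> H" "adj y x"
  using assms unfolding conn_def closed_in_def by blast

text \<open>By connectedness each triangle component of \<open>S - {x}\<close> has a vertex adjacent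
  to \<open>x\<close>. Once N[x] is removed, at most two of its vertices are left, and these carry
  no cycle.\<close>

lemma good_of_pendant_triangle:
  assumes fin: "finite S" and con: "conn S" and x: "x \<in> S"
    and IH: "\<And>C. C \<subset> S \<Longrightarrow> conn C \<Longrightarrow> \<not> triangle C \<Longrightarrow> good C"
    and H: "component (S - {x}) H" "triangle H"
  shows "good S"
proof -
  \<comment> \<open>All triangle components go at once, so that the components left over are
    components of \<open>S - {x}\<close> that are not triangles.\<close>
  define U where "U = \<Union>{H. component (S - {x}) H \<and> triangle H}"
  have US: "U \<subseteq> S - {x}" unfolding U_def component_def closed_in_def by blast
  have "card H \<le> card U" using H US fin
    by (intro card_mono) (auto simp: U_def intro: finite_subset)
  moreover have "finite U" using US fin by (meson finite_Diff finite_subset)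
  moreover have "x \<notin> U" using US by blast
  ultimately have card: "4 \<le> card (insert x U)" using H(2) unfolding triangle_def by simp
  show ?thesis
  proof (rule good_step[where X = "insert x U" and w = x])
    show "insert x U \<subseteq> S" using US x by blast
  next
    fix T assume T: "core T" "T \<subseteq> S" "x \<notin> T" "\<And>t. t \<in> T \<Longrightarrow> \<not> adj x t"
    show "T \<inter> insert x U = {}"
    proof (rule ccontr)
      assume "T \<inter> insert x U \<noteq> {}"
      then obtain t H' where t: "t \<in> T" "t \<in> H'" and H': "component (S - {x}) H'" "triangle H'"
        using T(3) unfolding U_def by blast
      have cl: "closed_in (S - {x}) H'" "H' \<noteq> {}" using H'(1) unfolding component_def by auto
      then have "H' \<subset> S" using x unfolding closed_in_def by blast
      then obtain y z where y: "y \<in> H'" "z \<in> S" "z \<notin> H'" "adj y z"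
        using exit_edge[OF con] cl by blast
      then have "z = x" using cl unfolding closed_in_def by blast
      then have yT: "y \<notin> T" using T(4) y adj_sym by blast
      then have "t \<noteq> y" using t by blast
      then obtain c where c: "H' = {y, t, c}"
        using triangle_third[OF H'(2) y(1) t(2)] by metis
      \<comment> \<open>\<open>y\<close> is removed with N[x], which leaves \<open>c\<close> as the
        only possible neighbour of \<open>t\<close> in \<open>T\<close>.\<close>
      have "t \<notin> T"
      proof (rule core_peel[OF T(1)])
        fix b assume b: "b \<in> T" "adj t b"
        then have "b \<in> H'" using cl t(2) T unfolding closed_in_def by blast
        then show "b = c" using c b yT adj_irrefl by blast
      qed
      then show False using t by blast
    qed
  next
    fix C assume C: "component (S - insert x U) C"
    have "closed_in (S - {x}) C" unfolding closed_in_def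
    proof (intro conjI ballI impI)
      show "C \<subseteq> S - {x}" using C unfolding component_def closed_in_def by blast
    next
      fix a b assume ab: "a \<in> C" "b \<in> S - {x}" "adj a b"
      have aS: "a \<in> S - insert x U" using C ab unfolding component_def closed_in_def by blast
      have "b \<notin> U"
      proof
        assume "b \<in> U"
        then obtain H' where H': "b \<in> H'" "component (S - {x}) H'" "triangle H'"
          unfolding U_def by blast
        then have "a \<in> H'"
          using ab adj_sym aS unfolding component_def closed_in_def by blast
        then show False using H' aS unfolding U_def by blast
      qed
      then show "b \<in> C" using C ab unfolding component_def closed_in_def by blast
    qed
    then have C2: "component (S - {x}) C" using C unfolding component_def by blast
    have "C \<inter> U = {}" using C unfolding component_def closed_in_def by blast
    then have "\<not> triangle C" using C2 unfolding U_def component_def by blast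
    then show "good C" using IH C2 x unfolding component_def closed_in_def by blast
  qed (use fin card x in auto)
qed

section \<open>Graphs of maximum degree at most two\<close>

definition nbrs :: "'a set \<Rightarrow> 'a \<Rightarrow> 'a set" where
  "nbrs S u = {w \<in> S. adj u w}"

text \<open>A vertex of a core has two neighbours inside the core; under the degree bound these are
  all its neighbours in \<open>S\<close>.\<close>

lemma core_closed_of_deg_le_2:
  assumes "finite S" "\<And>u. u \<in> S \<Longrightarrow> card (nbrs S u) \<le> 2" "core T" "T \<subseteq> S"
  shows "closed_in S T"
  unfolding closed_in_def
proof (intro conjI ballI impI)
  fix a b assume ab: "a \<in> T" "b \<in> S" "adj a b"
  obtain c d where cd: "c \<in> T" "d \<in> T" "c \<noteq> d" "adj a c" "adj a d"
    using assms(3) ab unfolding core_def by blast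
  have "card (nbrs S a) \<le> card {c, d}" using assms(2)[of a] ab(1) assms(4) cd(3) by auto
  moreover have "{c, d} \<subseteq> nbrs S a" "finite (nbrs S a)"
    using cd assms(1,4) unfolding nbrs_def by auto
  ultimately have "{c, d} = nbrs S a" by (intro card_seteq)
  then have "b \<in> {c, d}" using ab unfolding nbrs_def by blast
  then show "b \<in> T" using cd by blast
qed (use assms in auto)

text \<open>A core in \<open>S\<close> is closed, hence equal to \<open>S\<close> by connectedness,
  and any single vertex hits it. Its price is covered because \<open>S\<close> then has at least
  four vertices: a core on three vertices is a triangle.\<close>

lemma good_of_deg_le_2:
  assumes fin: "finite S" and con: "conn S" and nt: "\<not> triangle S"
    and deg: "\<And>u. u \<in> S \<Longrightarrow> card (nbrs S u) \<le> 2"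
  shows "good S"
proof (cases "\<exists>T\<subseteq>S. core T")
  case False
  then show ?thesis unfolding good_def by (intro exI[of _ "{}"]) auto
next
  case True
  have full: "T = S" if "T \<subseteq> S" "core T" for T
    using core_closed_of_deg_le_2[OF fin deg that(2,1)] con that unfolding conn_def core_def by blast
  then have cS: "core S" using True by blast
  then obtain v where v: "v \<in> S" unfolding core_def by blast
  then obtain a b where ab: "a \<in> S" "b \<in> S" "a \<noteq> b" "adj v a" "adj v b"
    using coreE[OF cS] by metis
  then have "card {v, a, b} = 3" using adj_irrefl by (auto simp: card_insert_if)
  moreover have "card {v, a, b} \<le> card S" using fin v ab by (intro card_mono) auto
  ultimately have ge: "3 \<le> card S" by simp
  have "card S \<noteq> 3"
  proof
    assume c3: "card S = 3"
    have "adj t u" if tu: "t \<in> S" "u \<in> S" "t \<noteq> u" for t u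
    proof -
      obtain a b where ab: "a \<in> S" "b \<in> S" "a \<noteq> b" "adj t a" "adj t b"
        using coreE[OF cS tu(1)] by metis
      then have "card {t, a, b} = 3" using adj_irrefl by (auto simp: card_insert_if)
      moreover have "{t, a, b} \<subseteq> S" using tu(1) ab by blast
      ultimately have "{t, a, b} = S" using fin c3 by (intro card_subset_eq) auto
      then have "u = a \<or> u = b" using tu(2,3) by blast
      then show ?thesis using ab(4,5) by blast
    qed
    then have "triangle S" using c3 unfolding triangle_def by simp
    then show False using nt by simp
  qed
  then have "4 \<le> card S" using ge by linarith
  moreover have "T \<inter> nbhd {v} \<noteq> {}" if "T \<subseteq> S" "core T" for T
    using full[OF that] v unfolding nbhd_def by blast
  ultimately show ?thesis unfolding good_def using v by (intro exI[of _ "{v}"]) auto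
qed

section \<open>The inductive proof of the upper bound\<close>

lemma good_of_conn:
  assumes "finite S" "conn S" "\<not> triangle S"
  shows "good S"
  using assms
proof (induction "card S" arbitrary: S rule: less_induct)
  case less
  note fin = less.prems(1) and con = less.prems(2)
  have IH: "good C" if "C \<subset> S" "conn C" "\<not> triangle C" for C
    using less.hyps[of C] that fin psubset_card_mono finite_subset by (metis psubset_imp_subset)
  show ?case
  proof (rule ccontr)
    assume bad: "\<not> good S"
    have pendant: "\<not> triangle C" if "x \<in> S" "component (S - {x}) C" for x C
      using good_of_pendant_triangle[OF fin con that(1) IH that(2)] bad by blast
    obtain u where u: "u \<in> S" "3 \<le> card (nbrs S u)"
      using good_of_deg_le_2[OF fin con less.prems(3)] bad by fastforce
    have img: "finite ((\<lambda>u. card (nbrs S u)) ` S)" using fin by simp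
    have "Max ((\<lambda>u. card (nbrs S u)) ` S) \<in> (\<lambda>u. card (nbrs S u)) ` S"
      using img u(1) by (intro Max_in) auto
    then obtain v where v: "v \<in> S" and "card (nbrs S v) = Max ((\<lambda>u. card (nbrs S u)) ` S)"
      by auto
    then have vmax: "card (nbrs S u) \<le> card (nbrs S v)" if "u \<in> S" for u
      using Max_ge[OF img] that by auto
    have fn: "finite (nbrs S z)" for z using fin unfolding nbrs_def by simp
    have v3: "3 \<le> card (nbrs S v)" using u vmax le_trans by blast
    define X where "X = insert v (nbrs S v)"
    have "v \<notin> nbrs S v" using adj_irrefl unfolding nbrs_def by blast
    then have "4 \<le> card X" using v3 fn unfolding X_def by simp
    moreover have "X \<subseteq> S" using v unfolding X_def nbrs_def by blast
    \<comment> \<open>Discarding N[v] with \<open>w = v\<close> can fail only through a bad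
      component of the rest, which by induction is a triangle.\<close>
    ultimately have "\<exists>H. component (S - X) H \<and> \<not> good H"
      using good_step[OF fin _ _ v, of X] bad unfolding X_def nbrs_def by blast
    then obtain H where H: "component (S - X) H" "\<not> good H" by blast
    then have HS: "H \<noteq> {}" "H \<subseteq> S - X" "closed_in (S - X) H" "conn H"
      unfolding component_def closed_in_def by auto
    have Hp: "H \<subset> S" using HS v unfolding X_def by blast
    then have Ht: "triangle H" using IH HS H by blast
    obtain y x where y: "y \<in> H" "x \<in> S" "x \<notin> H" "adj y x"
      using exit_edge[OF con Hp HS(1)] by blast
    \<comment> \<open>An edge leaving \<open>H\<close> must enter \<open>X\<close>, but not at
      \<open>v\<close>, since \<open>H\<close> avoids the neighbours of \<open>v\<close>.\<close>
    have exit: "z \<in> S \<and> z \<noteq> v \<and> adj v z" if "a \<in> H" "z \<in> S" "z \<notin> H" "adj a z" for a z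
    proof -
      have "z \<in> X" using HS(3) that unfolding closed_in_def by blast
      moreover have "z \<noteq> v" using HS(2) that adj_sym unfolding X_def nbrs_def by blast
      ultimately show ?thesis unfolding X_def nbrs_def by blast
    qed
    have xv: "adj v x" "x \<noteq> v" using exit y by blast+
    \<comment> \<open>With \<open>x\<close> as its only attachment, \<open>H\<close> would be a
      triangle component of \<open>S - {x}\<close>; hence a second neighbour \<open>p\<close> of
      \<open>v\<close> is attached to \<open>H\<close>.\<close>
    have "\<not> closed_in (S - {x}) H"
      using pendant[OF y(2)] Ht HS unfolding component_def by blast
    then obtain h p where h: "h \<in> H" "p \<in> S" "p \<noteq> x" "p \<notin> H" "adj h p"
      using HS(2) y(3) unfolding closed_in_def by blast
    have pv: "adj v p" "p \<noteq> v" using exit h by blast+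
    \<comment> \<open>Now \<open>H\<close> and \<open>x\<close> are discarded with
      \<open>w = y\<close>, which dominates all four vertices. Since \<open>S\<close> is bad, so is
      some component of the rest, which is again a triangle.\<close>
    obtain C where C: "component (S - insert x H) C" "\<not> good C"
    proof -
      have c4: "card (insert x H) = 4" using Ht y(3) unfolding triangle_def
        by (simp add: card_ge_0_finite)
      have dom: "z = y \<or> adj y z" if "z \<in> insert x H" for z
        using that y(1,4) Ht unfolding triangle_def by auto
      have "good S" if "\<And>C. component (S - insert x H) C \<Longrightarrow> good C"
      proof (rule good_step[where X = "insert x H" and w = y])
        show "T \<inter> insert x H = {}" if "y \<notin> T" "\<And>t. t \<in> T \<Longrightarrow> \<not> adj y t" for T
          using that dom by blast
      qed (use fin y HS c4 that in auto)
      then show ?thesis using that bad by blast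
    qed
    then have CS: "C \<noteq> {}" "C \<subseteq> S - insert x H" "closed_in (S - insert x H) C" "conn C"
      unfolding component_def closed_in_def by auto
    have Ct: "triangle C" using IH[of C] CS C(2) y(2) by blast
    have vS: "v \<in> S - insert x H" using v xv HS(2) unfolding X_def by blast
    \<comment> \<open>If \<open>v\<close> were outside \<open>C\<close>, no edge would join
      \<open>C\<close> to \<open>H\<close>, because every outside neighbour of \<open>H\<close> is
      adjacent to \<open>v\<close>. Then \<open>C\<close> would be a triangle component of
      \<open>S - {x}\<close>.\<close>
    have vC: "v \<in> C"
    proof (rule ccontr)
      assume nv: "v \<notin> C"
      have "closed_in (S - {x}) C" unfolding closed_in_def
      proof (intro conjI ballI impI)
        fix a b assume ab: "a \<in> C" "b \<in> S - {x}" "adj a b"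
        have "b \<notin> H"
        proof
          assume "b \<in> H"
          then have "adj v a" using exit[of b a] ab CS(2) adj_sym by blast
          then show False using nv vS CS(3) ab adj_sym unfolding closed_in_def by blast
        qed
        then show "b \<in> C" using ab CS(3) unfolding closed_in_def by blast
      qed (use CS in blast)
      then show False using pendant[OF y(2)] Ct CS unfolding component_def by blast
    qed
    have nv: "z \<in> insert x C" if "z \<in> S" "adj v z" for z
    proof -
      have "z \<notin> H" using that HS(2) unfolding X_def nbrs_def by blast
      then show ?thesis using that vC CS(3) unfolding closed_in_def by blast
    qed
    have pC: "p \<in> C" using nv[OF h(2) pv(1)] h(3) by blast
    obtain q where q: "C = {v, p, q}" "q \<noteq> v" "q \<noteq> p" "adj v p" "adj v q" "adj p q"
      using triangle_third[OF Ct vC pC] pv(2) by metis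
    have qS: "q \<in> S" "q \<noteq> x" "q \<notin> H" using CS(2) q(1) by auto
    have "nbrs S v \<subseteq> {x, p, q}" using nv q(1) adj_irrefl unfolding nbrs_def by blast
    then have "card (nbrs S v) \<le> card {x, p, q}" by (intro card_mono) auto
    also have "\<dots> \<le> 3" by (simp add: card_insert_if)
    \<comment> \<open>All neighbours of \<open>v\<close> lie in \<open>{x, p, q}\<close>, so the
      maximality of \<open>v\<close> bounds every degree by three.\<close>
    finally have D3: "\<And>u. u \<in> S \<Longrightarrow> card (nbrs S u) \<le> 3" using vmax le_trans by blast
    \<comment> \<open>Hence three known neighbours of a vertex are all of them.\<close>
    have three: "z \<in> {a, b, c}"
      if "u \<in> S" "a \<in> S" "b \<in> S" "c \<in> S" "a \<noteq> b" "a \<noteq> c" "b \<noteq> c"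
        "adj u a" "adj u b" "adj u c" "z \<in> S" "adj u z" for u a b c z
    proof -
      have "{a, b, c} = nbrs S u" using that D3[of u] fn by (intro card_seteq) (auto simp: nbrs_def)
      then show ?thesis using that unfolding nbrs_def by blast
    qed
    have Hmem: "a \<in> S" "a \<noteq> v" "a \<noteq> x" "a \<notin> C" if "a \<in> H" for a
      using that HS(2) CS(2) y(3) unfolding X_def by auto
    \<comment> \<open>A vertex \<open>y = h\<close> would have four neighbours: \<open>x\<close>,
      \<open>p\<close> and the other two vertices of \<open>H\<close>.\<close>
    have hy: "h \<noteq> y"
    proof
      assume "h = y"
      obtain b c where bc: "H = {y, b, c}" "b \<noteq> y" "c \<noteq> y" "c \<noteq> b" "adj y b" "adj y c"
        using triangle_other[OF Ht y(1)] by metis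
      then have "p \<in> {x, b, c}" using three[of y x b c p] y h \<open>h = y\<close> Hmem by auto
      then show False using h bc by auto
    qed
    obtain k where k: "H = {y, h, k}" "k \<noteq> y" "k \<noteq> h" "adj y h" "adj y k" "adj h k"
      using triangle_third[OF Ht y(1) h(1)] hy by metis
    have inS: "v \<in> S" "p \<in> S" "q \<in> S" "x \<in> S" "y \<in> S" "h \<in> S" "k \<in> S"
      using v h qS y Hmem k(1) by auto
    have pH: "p \<notin> H" "p \<noteq> h" "p \<noteq> k" "p \<noteq> y" "q \<noteq> h" "q \<noteq> k" "q \<noteq> y"
      "v \<noteq> h" "v \<noteq> k" "v \<noteq> y" "x \<noteq> h" "x \<noteq> k" "x \<noteq> y"
      using h(4) qS(3) y(3) vS k(1) by auto
    note sy = adj_sym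
    have Nv: "z \<in> {x, p, q}" if "z \<in> S" "adj v z" for z
      using three[of v x p q z] that inS xv q h(3) qS by auto
    have Np: "z \<in> {v, q, h}" if "z \<in> S" "adj p z" for z
      using three[of p v q h z] that inS q h pH sy by auto
    have Nh: "z \<in> {y, k, p}" if "z \<in> S" "adj h z" for z
      using three[of h y k p z] that inS k h pH sy by auto
    define Y where "Y = {v, p, q, x, y, h, k}"
    have Yeq: "Y = insert x (H \<union> C)" unfolding Y_def using k(1) q(1) by auto
    \<comment> \<open>Outside \<open>H \<union> C \<union> {x}\<close>, every remaining component is attached to \<open>x\<close> only.\<close>
    have compY: "good K" if K: "component (S - Y) K" for K
    proof -
      have KS: "K \<noteq> {}" "K \<subseteq> S - Y" "closed_in (S - Y) K" "conn K"
        using K unfolding component_def closed_in_def by auto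
      have "closed_in (S - {x}) K" unfolding closed_in_def
      proof (intro conjI ballI impI)
        show "K \<subseteq> S - {x}" using KS(2) unfolding Y_def by blast
        fix a b assume ab: "a \<in> K" "b \<in> S - {x}" "adj a b"
        have a: "a \<in> S" "a \<notin> C" "a \<notin> H" "a \<noteq> x" using ab KS(2) Yeq by auto
        have "b \<notin> C" using CS(3) ab a sy unfolding closed_in_def by blast
        moreover have "b \<notin> H"
        proof
          assume "b \<in> H"
          then have "adj v a" using exit[of b a] a ab sy by blast
          then show False using nv a by blast
        qed
        ultimately have "b \<in> S - Y" using ab Yeq by blast
        then show "b \<in> K" using ab KS(3) unfolding closed_in_def by blast
      qed
      then have "\<not> triangle K" using pendant[OF y(2)] KS unfolding component_def by blast
      moreover have "K \<subset> S" using KS(2) v unfolding Y_def by blast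
      ultimately show ?thesis using IH KS by blast
    qed
    have Yc: "4 \<le> card Y" "Y \<subseteq> S"
    proof -
      have "card {v, p, q, x} = 4" using pv xv q h(3) qS by (auto simp: card_insert_if)
      moreover have "card {v, p, q, x} \<le> card Y" unfolding Y_def by (intro card_mono) auto
      ultimately show "4 \<le> card Y" by simp
      show "Y \<subseteq> S" using inS unfolding Y_def by blast
    qed
    have "good S"
    proof (cases "adj q x")
      case False
      \<comment> \<open>Here \<open>w = h\<close>, which dominates \<open>y\<close>,
        \<open>k\<close> and \<open>p\<close>; then \<open>q\<close>, \<open>v\<close> and
        \<open>x\<close> drop out in this order.\<close>
      show ?thesis
      proof (rule good_step[OF fin Yc(2,1) inS(6) _ compY])
        fix T assume T: "core T" "T \<subseteq> S" "h \<notin> T" "\<And>t. t \<in> T \<Longrightarrow> \<not> adj h t"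
        have 1: "y \<notin> T" "k \<notin> T" "p \<notin> T" using T(4) k h sy by blast+
        \<comment> \<open>Peeling: each vertex has at most one neighbour left in \<open>T\<close> once the previous ones are
          excluded.\<close>
        have 2: "q \<notin> T"
        proof (rule core_peel[OF T(1), where a = v])
          fix b assume b: "b \<in> T" "adj q b"
          have "q \<in> C" "b \<in> S - insert x H" using b False T 1 k(1) q(1) by auto
          then have "b \<in> C" using CS(3) b(2) unfolding closed_in_def by blast
          then show "b = v" using b 1 q(1) adj_irrefl by blast
        qed
        have 3: "v \<notin> T"
          using core_peel[OF T(1), of v x] Nv T(2) 1 2 by blast
        \<comment> \<open>\<open>v\<close> and \<open>y\<close> are neighbours of \<open>x\<close>
          outside \<open>T\<close>, so degree at most three leaves room for one neighbour in
          \<open>T\<close>, while a core needs two.\<close>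
        have 4: "x \<notin> T"
        proof
          assume "x \<in> T"
          then obtain c d where cd: "c \<in> T" "d \<in> T" "c \<noteq> d" "adj x c" "adj x d"
            using T(1) unfolding core_def by blast
          then have "c \<in> {v, y, d}"
            using three[of x v y d c] inS T(2) xv y(4) sy 1 3 pH by blast
          then show False using cd 1 3 by blast
        qed
        show "T \<inter> Y = {}" using 1 2 3 4 T(3) unfolding Y_def by blast
      qed
    next
      case True
      \<comment> \<open>Here \<open>w = x\<close>, which dominates \<open>v\<close>,
        \<open>y\<close> and \<open>q\<close>; then \<open>p\<close>, \<open>h\<close> and
        \<open>k\<close> drop out in this order.\<close>
      show ?thesis
      proof (rule good_step[OF fin Yc(2,1) inS(4) _ compY])
        fix T assume T: "core T" "T \<subseteq> S" "x \<notin> T" "\<And>t. t \<in> T \<Longrightarrow> \<not> adj x t"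
        have 1: "v \<notin> T" "y \<notin> T" "q \<notin> T" using T(4) xv y(4) True sy by blast+
        have 2: "p \<notin> T"
          using core_peel[OF T(1), of p h] Np T(2) 1 by blast
        have 3: "h \<notin> T"
          using core_peel[OF T(1), of h k] Nh T(2) 1 2 by blast
        have 4: "k \<notin> T"
        proof
          assume "k \<in> T"
          then obtain c d where cd: "c \<in> T" "d \<in> T" "c \<noteq> d" "adj k c" "adj k d"
            using T(1) unfolding core_def by blast
          then have "c \<in> {h, y, d}"
            using three[of k h y d c] inS T(2) k sy 1 3 pH hy by blast
          then show False using cd 1 3 by blast
        qed
        show "T \<inter> Y = {}" using 1 2 3 4 T(3) unfolding Y_def by blast
      qed
    qed
    then show False using bad by blast
  qed
qed

end

section \<open>From vertex sets back to graphs\<close>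

text \<open>Any bijection of the vertices works. \<open>graph_iso\<close> also compares the
  singletons \<open>{u, u}\<close>, which is why loops are excluded explicitly.\<close>

lemma isoI_K3:
  assumes simp: "\<And>u. {u} \<notin> edges G" and card: "card (verts G) = 3"
    and adj: "\<And>u v. u \<in> verts G \<Longrightarrow> v \<in> verts G \<Longrightarrow> u \<noteq> v \<Longrightarrow> {u, v} \<in> edges G"
  shows "graph_iso G K3"
proof -
  have "finite (verts G)" using card by (intro card_ge_0_finite) simp
  then obtain f where f: "bij_betw f (verts G) {1..3::nat}"
    using finite_same_card_bij[of "verts G" "{1..3::nat}"] card by auto
  have "{u, v} \<in> edges G \<longleftrightarrow> {f u, f v} \<in> edges K3" if "u \<in> verts G" "v \<in> verts G" for u v
  proof (cases "u = v")
    case True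
    then show ?thesis using simp unfolding K3_def complete_graph_on_def
      by (auto simp: doubleton_eq_iff)
  next
    case False
    then have "f u \<noteq> f v" using f that unfolding bij_betw_def inj_on_def by blast
    moreover have "f u \<in> {1..3}" "f v \<in> {1..3}" using f that bij_betwE by blast+
    ultimately have "{f u, f v} \<in> edges K3" unfolding K3_def complete_graph_on_def by auto
    then show ?thesis using adj[OF that False] by simp
  qed
  moreover have "verts K3 = {1..3}" unfolding K3_def complete_graph_on_def by simp
  ultimately show ?thesis using f unfolding graph_iso_def by auto
qed

lemma graph_iso_K3D:
  assumes "graph_iso G K3"
  shows "card (verts G) = 3"
    and "u \<in> verts G \<Longrightarrow> v \<in> verts G \<Longrightarrow> u \<noteq> v \<Longrightarrow> {u, v} \<in> edges G"
proof -
  obtain f where f: "bij_betw f (verts G) {1..3::nat}"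
    "\<forall>u \<in> verts G. \<forall>v \<in> verts G. {u, v} \<in> edges G \<longleftrightarrow> {f u, f v} \<in> edges K3"
    using assms unfolding graph_iso_def K3_def complete_graph_on_def by auto
  show "card (verts G) = 3" using bij_betw_same_card[OF f(1)] by simp
  assume uv: "u \<in> verts G" "v \<in> verts G" "u \<noteq> v"
  then have "f u \<noteq> f v" using f(1) unfolding bij_betw_def inj_on_def by blast
  moreover have "f u \<in> {1..3}" "f v \<in> {1..3}" using f(1) uv bij_betwE by blast+
  ultimately have "{f u, f v} \<in> edges K3" unfolding K3_def complete_graph_on_def by auto
  then show "{u, v} \<in> edges G" using f(2) uv by simp
qed

text \<open>Predecessor and successor on the cycle serve as the two neighbours; length at least
  three keeps them apart.\<close>

lemma (in adjacency) core_of_cycle: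
  assumes "is_cycle G c" "\<And>u v. {u, v} \<in> edges G \<Longrightarrow> adj u v"
  shows "core (set c)"
  unfolding core_def
proof (intro conjI ballI)
  have c: "3 \<le> length c" "distinct c" "\<And>i. i < length c \<Longrightarrow> adj (c ! i) (c ! (Suc i mod length c))"
    using assms unfolding is_cycle_def by auto
  show "set c \<noteq> {}" using c(1) by auto
  fix t assume "t \<in> set c"
  then obtain i where i: "i < length c" "t = c ! i" by (metis in_set_conv_nth)
  \<comment> \<open>The cyclic predecessor of \<open>i\<close>; index 0 wraps round to the last
    position.\<close>
  define j where "j = (if i = 0 then length c - 1 else i - 1)"
  have j: "j < length c" "Suc j mod length c = i" using i(1) c(1) by (auto simp: j_def)
  have s: "Suc i mod length c < length c" using c(1) by (intro mod_less_divisor) auto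
  have ne: "Suc i mod length c \<noteq> j"
  proof (cases "Suc i = length c")
    case True
    then show ?thesis using c(1) by (auto simp: j_def)
  next
    case False
    then have "Suc i mod length c = Suc i" using i(1) by simp
    then show ?thesis using c(1) by (auto simp: j_def)
  qed
  have "adj t (c ! (Suc i mod length c))" using c(3)[OF i(1)] i(2) by simp
  moreover have "adj t (c ! j)" using c(3)[OF j(1)] j(2) i(2) adj_sym by simp
  moreover have "c ! (Suc i mod length c) \<noteq> c ! j"
    using ne s j(1) c(2) by (simp add: nth_eq_iff_index_eq)
  ultimately show "\<exists>a\<in>set c. \<exists>b\<in>set c. a \<noteq> b \<and> adj t a \<and> adj t b"
    using s j(1) by (meson nth_mem)
qed

lemma no_loop: "simple_graph G \<Longrightarrow> {u} \<notin> edges G"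
  unfolding simple_graph_def by (auto simp: doubleton_eq_iff)

text \<open>The edge relation of \<open>G\<close> instantiates the locale, and
  \<open>good_of_conn\<close> applies to the full vertex set. A cycle surviving the resulting
  \<open>D\<close> would be a core that misses N[D].\<close>

lemma iota_c_le:
  assumes sg: "simple_graph G" and cg: "connected_graph G" and ni: "\<not> graph_iso G K3"
  shows "4 * iota_c G \<le> card (verts G)"
proof -
  interpret adjacency "\<lambda>u v. {u, v} \<in> edges G"
    using no_loop[OF sg] by unfold_locales (auto simp: insert_commute)
  have vertsI: "v \<in> verts G" if "{u, v} \<in> edges G" for u v
    using that sg unfolding simple_graph_def by (auto simp: doubleton_eq_iff)
  have "conn (verts G)" unfolding conn_def
  proof (intro allI impI)
    fix A assume A: "closed_in (verts G) A \<and> A \<noteq> {}"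
    then obtain a where a: "a \<in> A" "a \<in> verts G" unfolding closed_in_def by blast
    have "v \<in> A" if "v \<in> verts G" for v
    proof -
      have "(\<lambda>x y. {x, y} \<in> edges G)\<^sup>*\<^sup>* a v" using cg a that unfolding connected_graph_def by blast
      then show ?thesis
        by (induction rule: rtranclp_induct) (use a A vertsI in \<open>auto simp: closed_in_def\<close>)
    qed
    then show "A = verts G" using A unfolding closed_in_def by blast
  qed
  moreover have "\<not> triangle (verts G)"
    using isoI_K3[of G] no_loop[OF sg] ni unfolding triangle_def by blast
  moreover have "finite (verts G)" using sg unfolding simple_graph_def by blast
  ultimately have "good (verts G)" using good_of_conn by blast
  then obtain D where D: "D \<subseteq> verts G" "4 * card D \<le> card (verts G)"
    "\<forall>T\<subseteq>verts G. core T \<longrightarrow> T \<inter> nbhd D \<noteq> {}" unfolding good_def by blast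
  have "cycle_isolating G D" unfolding cycle_isolating_def
  proof (intro conjI notI)
    assume "\<exists>c. is_cycle (induced_subgraph G (verts G - closed_nbhd_set G D)) c"
    then obtain c where c: "is_cycle (induced_subgraph G (verts G - closed_nbhd_set G D)) c" ..
    then have "core (set c)" by (rule core_of_cycle) (simp add: induced_subgraph_def)
    moreover have "set c \<subseteq> verts G - closed_nbhd_set G D"
      using c unfolding is_cycle_def induced_subgraph_def by auto
    moreover have "verts G \<inter> nbhd D \<subseteq> closed_nbhd_set G D"
      unfolding nbhd_def closed_nbhd_set_def closed_nbhd_def by (auto simp: insert_commute)
    ultimately show False using D(3) by blast
  qed (fact D(1))
  then have "iota_c G \<le> card D" unfolding iota_c_def by (intro Least_le) blast
  then show ?thesis using D(2) by linarith
qed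

text \<open>The full vertex set is isolating, so the \<open>LEAST\<close> in \<open>iota_c\<close>
  is a genuine minimum.\<close>

lemma iota_c_attained: "\<exists>D. cycle_isolating G D \<and> card D = iota_c G"
proof -
  have rest: "verts G - closed_nbhd_set G (verts G) = {}"
    unfolding closed_nbhd_set_def closed_nbhd_def by blast
  have "\<not> is_cycle (induced_subgraph G {}) c" for c
    unfolding is_cycle_def induced_subgraph_def by auto
  then have "cycle_isolating G (verts G)" unfolding cycle_isolating_def rest by blast
  then have "\<exists>D. cycle_isolating G D \<and> card D = card (verts G)" by blast
  then show ?thesis unfolding iota_c_def by (rule LeastI)
qed

section \<open>Connectivity and paths\<close>

lemma connected_graphI:
  assumes "\<And>u. u \<in> verts G \<Longrightarrow> (\<lambda>x y. {x, y} \<in> edges G)\<^sup>*\<^sup>* u c"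
  shows "connected_graph G"
proof -
  have "symp (\<lambda>x y. {x, y} \<in> edges G)" by (auto simp: symp_def insert_commute)
  then have "symp (\<lambda>x y. {x, y} \<in> edges G)\<^sup>*\<^sup>*" by (rule symp_rtranclp)
  then show ?thesis unfolding connected_graph_def
    using assms by (meson rtranclp_trans sympD)
qed

text \<open>Stated for an arbitrary relation \<open>r\<close>, so that it serves both
  \<open>path_graph\<close> and the path \<open>1..a\<close> inside \<open>B_K3\<close>.\<close>

lemma path_reaches_end:
  assumes "\<And>j. 1 \<le> j \<Longrightarrow> j < m \<Longrightarrow> r j (Suc j)" "1 \<le> i" "i \<le> (m::nat)"
  shows "r\<^sup>*\<^sup>* i m"
  using assms(3,2)
proof (induction rule: inc_induct)
  case (step k)
  then show ?case using assms(1)[of k] by (meson converse_rtranclp_into_rtranclp le_SucI)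
qed simp

lemma path_graph_props:
  "simple_graph (path_graph m)" "connected_graph (path_graph m)" "\<not> graph_iso (path_graph m) K3"
proof -
  show "simple_graph (path_graph m)"
    unfolding simple_graph_def path_graph_def by fastforce
  show "connected_graph (path_graph m)"
  proof (rule connected_graphI)
    fix u assume "u \<in> verts (path_graph m)"
    then show "(\<lambda>x y. {x, y} \<in> edges (path_graph m))\<^sup>*\<^sup>* u m"
      by (intro path_reaches_end) (auto simp: path_graph_def)
  qed
  show "\<not> graph_iso (path_graph m) K3"
  proof
    assume iso: "graph_iso (path_graph m) K3"
    then have "m = 3" using graph_iso_K3D(1) by (fastforce simp: path_graph_def)
    then have "{1, 3} \<in> edges (path_graph m)"
      using graph_iso_K3D(2)[OF iso, of 1 3] by (simp add: path_graph_def)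
    then show False by (auto simp: path_graph_def doubleton_eq_iff)
  qed
qed

section \<open>Structure of the extremal graph and its lower bound\<close>

text \<open>The names repeat the local abbreviations of \<open>B_K3\<close>, except that
  \<open>F i\<close> is only the vertex set of the triangle.\<close>

context
  fixes n a b :: nat and F :: "nat \<Rightarrow> nat set"
  assumes n: "4 \<le> n"
  defines "a \<equiv> n div 4" and "b \<equiv> n - 3 * a" and "F \<equiv> \<lambda>i. {b + 3 * i - 2..b + 3 * i}"
begin

lemma ab: "1 \<le> a" "a \<le> b" "b + 3 * a = n"
  using n unfolding a_def b_def by auto

lemma verts_B: "verts (B_K3 n) = {1..b} \<union> (\<Union>i\<in>{1..a}. F i)"
  using n unfolding B_K3_def Let_def a_def b_def F_def complete_graph_on_def by simp

text \<open>The flat disjunction separates path edges, leaves at \<open>a\<close>, triangle edges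
  and joining edges; it feeds both proof search and the case rule \<open>edge_B_E\<close>.\<close>

lemma edges_B:
  "e \<in> edges (B_K3 n) \<longleftrightarrow>
     (\<exists>i. e = {i, Suc i} \<and> 1 \<le> i \<and> i < a) \<or> (\<exists>i. e = {a, i} \<and> a < i \<and> i \<le> b) \<or>
     (\<exists>i x y. e = {x, y} \<and> 1 \<le> i \<and> i \<le> a \<and> x \<in> F i \<and> y \<in> F i \<and> x \<noteq> y) \<or>
     (\<exists>i x. e = {i, x} \<and> 1 \<le> i \<and> i \<le> a \<and> x \<in> F i)"
proof -
  have "edges (B_K3 n) = {{i, i + 1} |i. 1 \<le> i \<and> i < a} \<union> {{a, i} |i. i \<in> {1..b} - {1..a}}
    \<union> (\<Union>i\<in>{1..a}. {{u, v} |u v. u \<in> F i \<and> v \<in> F i \<and> u \<noteq> v})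
    \<union> {{i, x} |i x. i \<in> {1..a} \<and> x \<in> F i}"
    using n unfolding B_K3_def Let_def a_def b_def F_def path_graph_def complete_graph_on_def by simp
  moreover have "e \<in> {{i, i + 1} |i. 1 \<le> i \<and> i < a} \<longleftrightarrow> (\<exists>i. e = {i, Suc i} \<and> 1 \<le> i \<and> i < a)"
    by simp
  moreover have "i \<in> {1..b} - {1..a} \<longleftrightarrow> a < i \<and> i \<le> b" for i
    using ab(1) by auto
  then have "e \<in> {{a, i} |i. i \<in> {1..b} - {1..a}} \<longleftrightarrow> (\<exists>i. e = {a, i} \<and> a < i \<and> i \<le> b)"
    by simp
  moreover have "e \<in> (\<Union>i\<in>{1..a}. {{u, v} |u v. u \<in> F i \<and> v \<in> F i \<and> u \<noteq> v}) \<longleftrightarrow>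
    (\<exists>i x y. e = {x, y} \<and> 1 \<le> i \<and> i \<le> a \<and> x \<in> F i \<and> y \<in> F i \<and> x \<noteq> y)"
    by (simp add: Bex_def) metis
  moreover have "e \<in> {{i, x} |i x. i \<in> {1..a} \<and> x \<in> F i} \<longleftrightarrow>
    (\<exists>i x. e = {i, x} \<and> 1 \<le> i \<and> i \<le> a \<and> x \<in> F i)"
    by (simp add: conj_assoc)
  ultimately show ?thesis by (simp only: Un_iff disj_assoc)
qed

lemma edge_B_E:
  assumes "e \<in> edges (B_K3 n)"
  obtains i where "e = {i, Suc i}" "1 \<le> i" "i < a"
  | i where "e = {a, i}" "a < i" "i \<le> b"
  | i x y where "e = {x, y}" "1 \<le> i" "i \<le> a" "x \<in> F i" "y \<in> F i" "x \<noteq> y"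
  | i x where "e = {i, x}" "1 \<le> i" "i \<le> a" "x \<in> F i"
  using assms unfolding edges_B by (elim disjE exE conjE) (rule that; assumption)+

lemma triangle_edge_B: "1 \<le> i \<Longrightarrow> i \<le> a \<Longrightarrow> x \<in> F i \<Longrightarrow> y \<in> F i \<Longrightarrow> x \<noteq> y \<Longrightarrow> {x, y} \<in> edges (B_K3 n)"
  unfolding edges_B by blast

text \<open>Positivity of \<open>i\<close> matters: for \<open>i = 0\<close> the interval ends at
  \<open>b\<close>.\<close>

lemma F_gt: "x \<in> F i \<Longrightarrow> 1 \<le> i \<Longrightarrow> b < x"
  unfolding F_def by auto

lemma F_inj: "x \<in> F i \<Longrightarrow> x \<in> F j \<Longrightarrow> 1 \<le> i \<Longrightarrow> 1 \<le> j \<Longrightarrow> i = j"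
  unfolding F_def by auto

lemma verts_B_eq: "verts (B_K3 n) = {1..n}"
proof -
  have block: "x \<in> (\<Union>i\<in>{1..a}. F i)" if "b < x" "x \<le> n" for x
  proof -
    \<comment> \<open>This is (x - b) / 3 rounded up, the index of the block of three that contains
      \<open>x\<close>.\<close>
    define i where "i = (x - b + 2) div 3"
    have "1 \<le> i" "i \<le> a" "b + 3 * i - 2 \<le> x" "x \<le> b + 3 * i"
      using that ab unfolding i_def by presburger+
    then show ?thesis unfolding F_def by auto
  qed
  have "F i \<subseteq> {1..n}" if "1 \<le> i" "i \<le> a" for i
    using that ab unfolding F_def by auto
  moreover have "{1..b} \<subseteq> {1..n}" using ab by auto
  ultimately have "{1..b} \<union> (\<Union>i\<in>{1..a}. F i) \<subseteq> {1..n}" by fastforce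
  moreover have "{1..n} \<subseteq> {1..b} \<union> (\<Union>i\<in>{1..a}. F i)"
  proof
    fix x assume "x \<in> {1..n}"
    then show "x \<in> {1..b} \<union> (\<Union>i\<in>{1..a}. F i)"
      using block[of x] by (cases "x \<le> b") auto
  qed
  ultimately show ?thesis unfolding verts_B by blast
qed

lemma simple_B: "simple_graph (B_K3 n)"
  unfolding simple_graph_def
proof (intro conjI subsetI)
  show "finite (verts (B_K3 n))" by (simp add: verts_B_eq)
  have vF: "x \<in> verts (B_K3 n)" if "x \<in> F i" "1 \<le> i" "i \<le> a" for x i
    using that unfolding verts_B by auto
  have vb: "x \<in> verts (B_K3 n)" if "1 \<le> x" "x \<le> b" for x
    using that unfolding verts_B by auto
  have pair: "{x, y} \<in> {{u, v} |u v. u \<in> verts (B_K3 n) \<and> v \<in> verts (B_K3 n) \<and> u \<noteq> v}"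
    if "x \<in> verts (B_K3 n)" "y \<in> verts (B_K3 n)" "x \<noteq> y" for x y using that by blast
  fix e assume "e \<in> edges (B_K3 n)"
  then show "e \<in> {{u, v} |u v. u \<in> verts (B_K3 n) \<and> v \<in> verts (B_K3 n) \<and> u \<noteq> v}"
  proof (cases rule: edge_B_E)
    case (1 i)
    then show ?thesis using ab by (simp only:) (intro pair vb; simp)
  next
    case (2 i)
    then show ?thesis using ab by (simp only:) (intro pair vb; simp)
  next
    case (3 i x y)
    then show ?thesis using pair vF by simp
  next
    case (4 i x)
    then have "i \<le> b" "i \<noteq> x" using ab F_gt[of x i] by auto
    then show ?thesis using 4 pair vF vb by simp
  qed
qed

lemma connected_B: "connected_graph (B_K3 n)"
proof (rule connected_graphI)
  let ?r = "\<lambda>x y. {x, y} \<in> edges (B_K3 n)"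
  have path: "?r\<^sup>*\<^sup>* i a" if "1 \<le> i" "i \<le> a" for i
  proof (rule path_reaches_end[OF _ that])
    fix j assume "1 \<le> j" "j < a"
    then show "?r j (Suc j)" unfolding edges_B by blast
  qed
  fix u assume "u \<in> verts (B_K3 n)"
  then consider "1 \<le> u" "u \<le> a" | "a < u" "u \<le> b" | i where "u \<in> F i" "1 \<le> i" "i \<le> a"
    unfolding verts_B by fastforce
  then show "?r\<^sup>*\<^sup>* u a"
  proof cases
    case 1
    then show ?thesis by (rule path)
  next
    case 2
    then have "?r u a" unfolding edges_B by (blast intro: insert_commute)
    then show ?thesis by blast
  next
    case 3
    then have "{i, u} \<in> edges (B_K3 n)" unfolding edges_B by blast
    then have "?r u i" by (simp add: insert_commute)
    then show ?thesis using path[OF 3(2,3)] by (rule converse_rtranclp_into_rtranclp)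
  qed
qed

text \<open>\<open>u\<close> lies beyond \<open>b\<close>, which rules out path and leaf edges, and
  belongs to one triangle only. So \<open>F i\<close> can be dominated only from its own
  block.\<close>

lemma nbr_of_F:
  assumes "u \<in> F i" "1 \<le> i" "i \<le> a" "{u, d} \<in> edges (B_K3 n)"
  shows "d \<in> insert i (F i)"
proof -
  have u: "b < u" using F_gt assms by blast
  from assms(4) show ?thesis
  proof (cases rule: edge_B_E)
    case (1 j)
    then show ?thesis using u ab by (auto simp: doubleton_eq_iff)
  next
    case (2 j)
    then show ?thesis using u ab by (auto simp: doubleton_eq_iff)
  next
    case (3 j x y)
    then have "u \<in> F j" "d \<in> F j" by (auto simp: doubleton_eq_iff)
    then show ?thesis using F_inj[OF assms(1) _ assms(2) 3(2)] by simp
  next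
    case (4 j x)
    then have "u = x" "d = j" using u ab by (auto simp: doubleton_eq_iff)
    then show ?thesis using F_inj[OF assms(1) _ assms(2) 4(2)] 4(4) by simp
  qed
qed

text \<open>If \<open>D\<close> misses the block, no vertex of \<open>F i\<close> is dominated, and
  the whole triangle survives as a cycle.\<close>

lemma isolating_hits_block:
  assumes D: "cycle_isolating (B_K3 n) D" and i: "1 \<le> i" "i \<le> a"
  shows "D \<inter> insert i (F i) \<noteq> {}"
proof
  assume e: "D \<inter> insert i (F i) = {}"
  define p where "p = b + 3 * i - 2"
  have Fi: "F i = {p, p + 1, p + 2}" using i unfolding F_def p_def by auto
  let ?W = "verts (B_K3 n) - closed_nbhd_set (B_K3 n) D"
  have "F i \<inter> closed_nbhd_set (B_K3 n) D = {}"
    using nbr_of_F[OF _ i] e unfolding closed_nbhd_set_def closed_nbhd_def by blast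
  moreover have "F i \<subseteq> verts (B_K3 n)" using i unfolding verts_B by auto
  ultimately have FW: "F i \<subseteq> ?W" by blast
  have ed: "{x, y} \<in> edges (induced_subgraph (B_K3 n) ?W)" if "x \<in> F i" "y \<in> F i" "x \<noteq> y" for x y
  proof -
    have "{x, y} \<in> edges (B_K3 n)" using triangle_edge_B[OF i that] .
    moreover have "{x, y} \<subseteq> ?W" using that FW by blast
    ultimately show ?thesis unfolding induced_subgraph_def by simp
  qed
  have "is_cycle (induced_subgraph (B_K3 n) ?W) [p, p + 1, p + 2]"
    unfolding is_cycle_def
  proof (intro conjI allI impI)
    fix k assume "k < length [p, p + 1, p + 2]"
    then consider "k = 0" | "k = 1" | "k = 2" by fastforce
    then show "{[p, p + 1, p + 2] ! k, [p, p + 1, p + 2] ! (Suc k mod length [p, p + 1, p + 2])}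
      \<in> edges (induced_subgraph (B_K3 n) ?W)"
      by cases (auto simp: Fi intro!: ed)
  next
    show "set [p, p + 1, p + 2] \<subseteq> verts (induced_subgraph (B_K3 n) ?W)"
      using FW Fi unfolding induced_subgraph_def by auto
  qed auto
  then show False using D unfolding cycle_isolating_def by blast
qed

text \<open>Path vertices are at most \<open>b\<close>, triangle vertices exceed \<open>b\<close>,
  and distinct triangles are disjoint.\<close>

lemma blocks_disjoint:
  assumes "1 \<le> i" "i \<le> a" "1 \<le> j" "j \<le> a" "x \<in> insert i (F i)" "x \<in> insert j (F j)"
  shows "i = j"
  using assms F_inj[of x i j] F_gt[of x i] F_gt[of x j] ab(2) by auto

text \<open>Choosing one element of \<open>D\<close> in each of the \<open>a\<close> disjoint blocks
  gives an injection of \<open>{1..a}\<close> into \<open>D\<close>.\<close>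

lemma iota_c_B_ge: "n div 4 \<le> iota_c (B_K3 n)"
proof -
  obtain D where D: "cycle_isolating (B_K3 n) D" "card D = iota_c (B_K3 n)"
    using iota_c_attained by blast
  have "\<forall>i\<in>{1..a}. \<exists>x. x \<in> D \<and> x \<in> insert i (F i)"
    using isolating_hits_block[OF D(1)] by fastforce
  then obtain f where f: "\<And>i. i \<in> {1..a} \<Longrightarrow> f i \<in> D \<and> f i \<in> insert i (F i)"
    by metis
  have "inj_on f {1..a}"
  proof (rule inj_onI)
    fix i j assume "i \<in> {1..a}" "j \<in> {1..a}" "f i = f j"
    then show "i = j" using blocks_disjoint[of i j "f i"] f[of i] f[of j] by auto
  qed
  moreover have "f ` {1..a} \<subseteq> D" using f by blast
  moreover have "finite D"
    using D(1) finite_subset[of D "{1..n}"] verts_B_eq unfolding cycle_isolating_def by auto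
  ultimately have "card {1..a} \<le> card D" by (rule card_inj_on_le)
  then show ?thesis using D(2) unfolding a_def by simp
qed

end

section \<open>Exact values and the maximum\<close>

text \<open>For \<open>n\<close> at most 3 the graph is a path and \<open>n div 4 = 0\<close>;
  otherwise it has at least four vertices, too many for \<open>K3\<close>.\<close>

lemma B_K3_props:
  shows "simple_graph (B_K3 n)" "connected_graph (B_K3 n)" "verts (B_K3 n) = {1..n}"
    "\<not> graph_iso (B_K3 n) K3" "n div 4 \<le> iota_c (B_K3 n)"
proof -
  have "simple_graph (B_K3 n) \<and> connected_graph (B_K3 n) \<and> verts (B_K3 n) = {1..n} \<and>
    \<not> graph_iso (B_K3 n) K3 \<and> n div 4 \<le> iota_c (B_K3 n)"
  proof (cases "n \<le> 3")
    case True
    then have "B_K3 n = path_graph n" by (simp add: B_K3_def)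
    then show ?thesis using True path_graph_props[of n] by (simp add: path_graph_def)
  next
    case False
    then have n: "4 \<le> n" by simp
    then have "\<not> graph_iso (B_K3 n) K3"
      using graph_iso_K3D(1)[of "B_K3 n"] verts_B_eq[OF n] by auto
    then show ?thesis using simple_B[OF n] connected_B[OF n] verts_B_eq[OF n] iota_c_B_ge[OF n]
      by simp
  qed
  then show "simple_graph (B_K3 n)" "connected_graph (B_K3 n)" "verts (B_K3 n) = {1..n}"
    "\<not> graph_iso (B_K3 n) K3" "n div 4 \<le> iota_c (B_K3 n)" by auto
qed

lemma iota_c_B_eq: "iota_c (B_K3 n) = n div 4"
  using iota_c_le[OF B_K3_props(1,2,4), of n] B_K3_props(3,5)[of n] by simp

lemma iota_c_max_eq: "iota_c_max n = n div 4"
  unfolding iota_c_max_def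
proof (rule Max_eqI)
  let ?A = "{iota_c G |G :: nat sgraph.
    simple_graph G \<and> connected_graph G \<and> verts G = {1..n} \<and> \<not> graph_iso G K3}"
  show le: "k \<le> n div 4" if k: "k \<in> ?A" for k
  proof -
    obtain G :: "nat sgraph" where G: "k = iota_c G \<and> simple_graph G \<and> connected_graph G \<and>
      verts G = {1..n} \<and> \<not> graph_iso G K3" using k unfolding mem_Collect_eq ..
    then have "4 * iota_c G \<le> card (verts G)" by (intro iota_c_le) simp_all
    then show ?thesis using G by simp
  qed
  \<comment> \<open>Finiteness of the set of values comes from the upper bound rather than from
    counting graphs.\<close>
  have "?A \<subseteq> {..n div 4}" by (rule subsetI, unfold atMost_iff, rule le)
  then show "finite ?A" by (rule finite_subset) simp
  show "n div 4 \<in> ?A"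
    unfolding mem_Collect_eq using B_K3_props(1-4)[of n] iota_c_B_eq[of n]
    by (intro exI[of _ "B_K3 n"] conjI) simp_all
qed

theorem theorem1p1:
  "(\<forall>(G :: 'a sgraph) (n :: nat).
      simple_graph G \<and> connected_graph G \<and> card (verts G) = n \<and> \<not> graph_iso G K3 \<longrightarrow>
      real (iota_c G) \<le> real n / 4) \<and>
   (\<forall>n :: nat. n \<ge> 1 \<longrightarrow>
      iota_c_max n = iota_c (B_K3 n) \<and> iota_c (B_K3 n) = nat \<lfloor>real n / 4\<rfloor>)"
proof (intro conjI allI impI)
  fix G :: "'a sgraph" and n :: nat
  assume G: "simple_graph G \<and> connected_graph G \<and> card (verts G) = n \<and> \<not> graph_iso G K3"
  then have "4 * iota_c G \<le> card (verts G)" by (intro iota_c_le) simp_all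
  then have "4 * iota_c G \<le> n" using G by simp
  then show "real (iota_c G) \<le> real n / 4" by linarith
next
  fix n :: nat
  show "iota_c_max n = iota_c (B_K3 n)" by (simp add: iota_c_max_eq iota_c_B_eq)
  show "iota_c (B_K3 n) = nat \<lfloor>real n / 4\<rfloor>"
    using floor_divide_of_nat_eq[of n 4, where 'a = real] by (simp add: iota_c_B_eq)
qed

end
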